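(* Let $n=2m$ and let $(\mathbb{F}_{2^m},+,\diamond)$ be a (left) pre-quasifield, where $+$ is the addition of the field $\mathbb{F}_{2^m}$. Let $g:\mathbb{F}_{2^m}\to\mathbb{F}_2$ be a balanced Boolean function with $g(0)=0$. Then the function $f:\mathbb{F}_{2^m}\times\mathbb{F}_{2^m}\to\mathbb{F}_2$ defined by $$f(x,y)=g\left(\diamond\frac{y}{x}\right)$$ is a $\mathcal{PS}^-$ bent function, i.e. it is a $\mathcal{PS}^-$ function and it is bent.
   Context: Pre-quasifield: a finite set $Q$ with binary operations $+,\diamond$ is a finite left pre-quasifield if (1) $(Q,+)$ is an Abelian group with identity $0$; (2) $(Q^*,\diamond)$ is a quasigroup, where $Q^*=Q\setminus\{0\}$, i.e. for every $a\in Q^*$ the maps $x\mapsto a\diamond x$ and $x\mapsto x\diamond a$ are bijections of $Q^*$ onto itself; (3) $x\diamond(y+z)=x\diamond y+x\diamond z$ for all $x,y,z\in Q$; (4) $0\diamond x=0$ for all $x\in Q$. Division: for $x\in\mathbb{F}_{2^m}^*$ and $y\in\mathbb{F}_{2^m}$, $\diamond\frac{y}{x}$ denotes the unique $a\in\mathbb{F}_{2^m}$ with $y=a\diamond x$; moreover $\diamond\frac{y}{0}=0$ for all $y\in\mathbb{F}_{2^m}$. Balanced: $g:\mathbb{F}_{2^m}\to\mathbb{F}_2$ is balanced if it takes the value $1$ exactly $2^{m-1}$ times. Spread: an $m$-dimensional spread of a $2m$-dimensional $\mathbb{F}_2$-vector space $V$ is a family $\{V_i\}_{i=1}^{2^m+1}$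 of $m$-dimensional subspaces with $V=\bigcup_i V_i$ and $V_i\cap V_j=\{0\}$ for $i\ne j$; its members are called components. $\mathcal{PS}^-$ function: a function $f:V\to\mathbb{F}_2$ is a $\mathcal{PS}^-$ function if there are an $m$-dimensional spread of $V$ and $2^{m-1}$ distinct components $V_1,\dots,V_{2^{m-1}}$ of it such that $f(v)=\sum_{i=1}^{2^{m-1}}\mathbf{1}_{V_i}(v) \bmod 2$ for all $v\in V$, where $\mathbf{1}_S$ is the characteristic function of $S$. Here $V=\mathbb{F}_{2^m}\times\mathbb{F}_{2^m}$. Bent: let $\mathrm{tr}_1^m(x)=\sum_{i=0}^{m-1}x^{2^i}$ be the trace from $\mathbb{F}_{2^m}$ to $\mathbb{F}_2$. The Walsh transform of $f$ at $(u,v)$ is $\hat f(u,v)=\sum_{(x,y)\in\mathbb{F}_{2^m}\times\mathbb{F}_{2^m}}(-1)^{f(x,y)+\mathrm{tr}_1^m(ux+vy)}$, and $f$ is bent if $|\hat f(u,v)|=2^{n/2}=2^{m}$ for all $(u,v)\in\mathbb{F}_{2^m}\times\mathbb{F}_{2^m}$.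
   Formalization: The PS^- claim is stated only for m >= 2, since for m = 1 it is always false: a single component is summed, so a PS^- function is 1 at the origin, while f(0,0) = g(0) = 0 (e.g. f(x,y) = xy over F_2). Bentness is stated for every m >= 1. *)

theory Defs
  imports Complex_Main "HOL-Library.Z2" "HOL-Library.Product_Plus" "HOL-Library.Indicator_Function" "HOL-Library.Cardinality"
    "HOL-Computational_Algebra.Primes" "HOL-Number_Theory.Residues"
begin

text \<open>
  The field with \<open>2 ^ m\<close> elements is a type \<^typ>\<open>'a::finite_field\<close> with \<open>CARD('a) = 2 ^ m\<close>, the field
  with two elements is \<^typ>\<open>bit\<close>, and the ambient space is \<^typ>\<open>'a \<times> 'a\<close>.
\<close>

section \<open>Pre-quasifields\<close>

locale finite_left_prequasifield =
  fixes dia :: "'q::{ab_group_add,finite} \<Rightarrow> 'q \<Rightarrow> 'q"  (infixl "\<diamondop>" 70)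
  assumes bij_left: "a \<noteq> 0 \<Longrightarrow> bij_betw (\<lambda>x. a \<diamondop> x) (UNIV - {0}) (UNIV - {0})"
    and bij_right: "a \<noteq> 0 \<Longrightarrow> bij_betw (\<lambda>x. x \<diamondop> a) (UNIV - {0}) (UNIV - {0})"
    and distrib_left: "x \<diamondop> (y + z) = x \<diamondop> y + x \<diamondop> z"
    and zero_left: "0 \<diamondop> x = 0"

definition prequasi_div :: "('q::zero \<Rightarrow> 'q \<Rightarrow> 'q) \<Rightarrow> 'q \<Rightarrow> 'q \<Rightarrow> 'q" where
  "prequasi_div dia y x = (if x = 0 then 0 else THE a. y = dia a x)"

context finite_left_prequasifield
begin

lemma ex1_quotient:
  assumes "x \<noteq> 0"
  shows "\<exists>!a. y = a \<diamondop> x"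
proof -
  have b: "bij_betw (\<lambda>a. a \<diamondop> x) (UNIV - {0}) (UNIV - {0})"
    using assms by (rule bij_right)
  have nz: "a \<diamondop> x \<noteq> 0" if "a \<noteq> 0" for a
    using bij_betwE[OF b] that by auto
  have inj: "a = a'" if "a \<diamondop> x = a' \<diamondop> x" for a a'
  proof (cases "a = 0 \<or> a' = 0")
    case True
    then show ?thesis using that nz zero_left by metis
  next
    case False
    then show ?thesis using that bij_betw_imp_inj_on[OF b] by (auto dest: inj_onD)
  qed
  have "\<exists>a. y = a \<diamondop> x"
  proof (cases "y = 0")
    case True
    then show ?thesis using zero_left by metis
  next
    case False
    then have "y \<in> (\<lambda>a. a \<diamondop> x) ` (UNIV - {0})"
      using bij_betw_imp_surj_on[OF b] by simp
    then show ?thesis by blast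
  qed
  then show ?thesis using inj by metis
qed

lemma prequasi_div_mult: "x \<noteq> 0 \<Longrightarrow> prequasi_div dia y x \<diamondop> x = y"
  unfolding prequasi_div_def using theI'[OF ex1_quotient[of x y]] by simp

end

section \<open>Boolean functions\<close>

definition balanced :: "nat \<Rightarrow> ('a::finite \<Rightarrow> bit) \<Rightarrow> bool" where
  "balanced m g \<longleftrightarrow> card {x. g x = 1} = 2 ^ (m - 1)"

definition field_trace :: "nat \<Rightarrow> 'a::finite_field \<Rightarrow> 'a" where
  "field_trace m x = (\<Sum>i<m. x ^ (2 ^ i))"

text \<open>
  The sum above is an element of the big field; \<open>trace_bit\<close> is the same value, which lies in the
  prime field, read as a \<^typ>\<open>bit\<close> (see \<open>of_bit_trace_bit\<close> below).
\<close>

definition trace_bit :: "nat \<Rightarrow> 'a::finite_field \<Rightarrow> bit" where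
  "trace_bit m x = of_bool (field_trace m x \<noteq> 0)"

definition walsh :: "nat \<Rightarrow> ('a::finite_field \<times> 'a \<Rightarrow> bit) \<Rightarrow> 'a \<Rightarrow> 'a \<Rightarrow> int" where
  "walsh m f u v =
     (\<Sum>(x, y)\<in>UNIV. (- 1) ^ (of_bit (f (x, y) + trace_bit m (u * x + v * y)) :: nat))"

definition bent :: "nat \<Rightarrow> ('a::finite_field \<times> 'a \<Rightarrow> bit) \<Rightarrow> bool" where
  "bent m f \<longleftrightarrow> (\<forall>u v. \<bar>walsh m f u v\<bar> = 2 ^ m)"

lemma CHAR_eq_2:
  assumes "card (UNIV :: 'a::finite_field set) = 2 ^ m"
  shows "CHAR('a) = 2"
proof -
  have "CHAR('a) dvd 2 ^ m"
    using CHAR_dvd_CARD[where 'a = 'a] assms by simp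
  then show ?thesis
    by (metis CHAR_prime prime_dvd_power primes_dvd_imp_eq two_is_prime_nat)
qed

lemma double_eq_0:
  assumes "card (UNIV :: 'a::finite_field set) = 2 ^ m"
  shows "(x::'a) + x = 0"
proof -
  have "(2::'a) = of_nat CHAR('a)"
    using CHAR_eq_2[OF assms] by simp
  then have "(2::'a) = 0" by simp
  then show ?thesis by (metis mult_2 mult_zero_left)
qed

lemma of_bit_trace_bit:
  fixes x :: "'a::finite_field"
  assumes "CARD('a) = 2 ^ m"
  shows "of_bit (trace_bit m x) = field_trace m x"
proof -
  have "2 \<le> CARD('a)"
    using card_mono[of UNIV "{0, 1 :: 'a}"] by simp
  then obtain k where k: "m = Suc k"
    using assms by (cases m) auto
  have sq: "(a + b) ^ 2 = a ^ 2 + b ^ 2" for a b :: 'a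
    using double_eq_0[OF assms, of "a * b"] by (simp add: power2_eq_square algebra_simps)
  have sum_sq: "(\<Sum>i<n. x ^ (2 ^ i)) ^ 2 = (\<Sum>i<n. x ^ (2 ^ Suc i))" for n
    by (induction n) (simp_all add: sq power_mult[symmetric] mult.commute)
  have "x ^ (2 ^ m) = x"
    using finite_field_power_card_eq_same[of x] assms by simp
  then have "(\<Sum>i<m. x ^ (2 ^ Suc i)) = (\<Sum>i<m. x ^ (2 ^ i))"
    unfolding k by (subst (2) sum.lessThan_Suc_shift) (simp add: add.commute)
  then have "field_trace m x ^ 2 = field_trace m x"
    unfolding field_trace_def by (simp only: sum_sq)
  then have "field_trace m x * (field_trace m x - 1) = 0"
    by (simp add: power2_eq_square algebra_simps)
  then have "field_trace m x = 0 \<or> field_trace m x = 1" by simp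
  then show ?thesis by (auto simp: trace_bit_def)
qed

section \<open>Spreads and partial spread functions\<close>

definition scale_bit :: "bit \<Rightarrow> 'a::finite_field \<times> 'a \<Rightarrow> 'a \<times> 'a" where
  "scale_bit c v = (of_bit c * fst v, of_bit c * snd v)"

lemma vector_space_scale_bit:
  assumes "card (UNIV :: 'a::finite_field set) = 2 ^ m"
  shows "vector_space (scale_bit :: bit \<Rightarrow> 'a \<times> 'a \<Rightarrow> 'a \<times> 'a)"
proof
  fix a b :: bit and x :: "'a \<times> 'a"
  show "scale_bit (a + b) x = scale_bit a x + scale_bit b x"
    by (cases a; cases b)
       (auto simp: scale_bit_def prod_eq_iff double_eq_0[OF assms])
qed (auto simp: scale_bit_def prod_eq_iff algebra_simps)

definition spread :: "nat \<Rightarrow> ('a::finite_field \<times> 'a) set set \<Rightarrow> bool" where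
  "spread m S \<longleftrightarrow>
     card S = 2 ^ m + 1 \<and>
     (\<forall>W\<in>S. module.subspace scale_bit W \<and> vector_space.dim scale_bit W = m) \<and>
     \<Union> S = UNIV \<and>
     (\<forall>W\<in>S. \<forall>W'\<in>S. W \<noteq> W' \<longrightarrow> W \<inter> W' = {0})"

text \<open>The sum is taken in \<^typ>\<open>bit\<close>, that is, modulo 2.\<close>

definition PS_minus :: "nat \<Rightarrow> ('a::finite_field \<times> 'a \<Rightarrow> bit) \<Rightarrow> bool" where
  "PS_minus m f \<longleftrightarrow>
     (\<exists>S C. spread m S \<and> C \<subseteq> S \<and> card C = 2 ^ (m - 1) \<and>
        (\<forall>v. f v = (\<Sum>W\<in>C. indicator W v)))"

text \<open>
  For \<open>m = 1\<close> a single component is summed, and the value at the origin is 1 rather than 0.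
\<close>

lemma PS_minus_1_origin:
  fixes f :: "'a::finite_field \<times> 'a \<Rightarrow> bit"
  assumes "CARD('a) = 2" and "PS_minus 1 f"
  shows "f (0, 0) = 1"
proof -
  interpret vector_space "scale_bit :: bit \<Rightarrow> 'a \<times> 'a \<Rightarrow> 'a \<times> 'a"
    using vector_space_scale_bit[of 1] assms(1) by simp
  obtain S C where S: "spread 1 S" and C: "C \<subseteq> S" "card C = 1"
    and f: "\<And>v. f v = (\<Sum>W\<in>C. indicator W v)"
    using assms(2) unfolding PS_minus_def by auto
  obtain W where W: "C = {W}"
    using C(2) by (auto simp: card_1_singleton_iff)
  then have "subspace W" using S C(1) by (simp add: spread_def)
  then have "0 \<in> W" by (rule subspace_0)
  then show ?thesis by (simp add: f W zero_prod_def)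
qed

end

theory Submission
  imports Defs "HOL-Computational_Algebra.Polynomial"
begin

text \<open>
  The components are the line at infinity \<open>{0} \<times> F\<close> and the graphs of \<open>x \<mapsto> a \<diamondop> x\<close>. Summing over
  lines through the origin, and since \<open>g\<close> is balanced, the Walsh transform equals
  \<open>S + (\<Sum>a. (-1) ^ g a * T a)\<close>, where \<open>S\<close> and \<open>T a\<close> are the sums of the additive character over the
  components. Each of these is \<open>0\<close> or \<open>2 ^ m\<close>. Unless the character is trivial, its sum over the whole
  plane vanishes, which forces \<open>S + (\<Sum>a. T a) = 2 ^ m\<close>, so exactly one component contributes.
\<close>

section \<open>Additive characters with values \<open>\<plusminus> 1\<close>\<close>

definition bit_sign :: "bit \<Rightarrow> int" where
  "bit_sign b = (- 1) ^ (of_bit b :: nat)"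

lemma bit_sign_simps [simp]: "bit_sign 0 = 1" "bit_sign 1 = - 1"
  by (simp_all add: bit_sign_def)

lemma bit_sign_add: "bit_sign (a + b) = bit_sign a * bit_sign b"
  by (cases a; cases b) simp_all

text \<open>Translating the summation variable by some \<open>z\<close> with
  \<open>\<chi> z = 1\<close> flips every sign, so a nontrivial character sum equals its own
  negative.\<close>

lemma sum_bit_sign_additive:
  fixes \<chi> :: "'b::{ab_group_add,finite} \<Rightarrow> bit"
  assumes add: "\<And>x y. \<chi> (x + y) = \<chi> x + \<chi> y"
  shows "(\<Sum>x\<in>UNIV. bit_sign (\<chi> x)) = (if \<forall>x. \<chi> x = 0 then int CARD('b) else 0)"
proof (cases "\<forall>x. \<chi> x = 0")
  case False
  then obtain z where z: "\<chi> z = 1" by auto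
  have "(\<Sum>x\<in>UNIV. bit_sign (\<chi> x)) = (\<Sum>x\<in>UNIV. bit_sign (\<chi> (x + z)))"
    by (rule sum.reindex_bij_witness[of _ "\<lambda>x. x + z" "\<lambda>x. x - z"]) auto
  also have "\<dots> = - (\<Sum>x\<in>UNIV. bit_sign (\<chi> x))"
    by (simp only: add z bit_sign_add) (simp add: sum_negf)
  finally show ?thesis using False by auto
qed simp

lemma sum_bit_sign_balanced:
  fixes g :: "'a::finite \<Rightarrow> bit"
  assumes "CARD('a) = 2 ^ m" "0 < m" "balanced m g"
  shows "(\<Sum>a\<in>UNIV. bit_sign (g a)) = 0"
proof -
  have "bit_sign (g a) = 1 - 2 * of_bool (g a = 1)" for a
    by (cases "g a") auto
  then have "(\<Sum>a\<in>UNIV. bit_sign (g a)) = int CARD('a) - 2 * (\<Sum>a\<in>UNIV. of_bool (g a = 1))"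
    by (simp add: sum_subtractf sum_distrib_left)
  also have "(\<Sum>a\<in>UNIV. of_bool (g a = 1)) = int (2 ^ (m - 1))"
    using assms(3) by (simp add: balanced_def sum.If_cases of_bool_def)
  also have "int CARD('a) - 2 * int (2 ^ (m - 1)) = 0"
    using assms(1,2) by (cases m) simp_all
  finally show ?thesis .
qed

lemma CARD_eq_power_imp_pos:
  assumes "card (UNIV :: 'a::finite_field set) = 2 ^ m"
  shows "0 < m"
proof -
  have "2 \<le> CARD('a)"
    using card_mono[of UNIV "{0, 1 :: 'a}"] by simp
  then show ?thesis using assms by (cases m) auto
qed

text \<open>In characteristic 2 squaring is additive, hence so is each of its iterates
  \<open>x ^ (2 ^ i)\<close>.\<close>

lemma field_trace_add:
  fixes x y :: "'a::finite_field"
  assumes "CARD('a) = 2 ^ m"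
  shows "field_trace m (x + y) = field_trace m x + field_trace m y"
proof -
  have sq: "(a + b) ^ 2 = a ^ 2 + b ^ 2" for a b :: 'a
    using double_eq_0[OF assms, of "a * b"] by (simp add: power2_eq_square algebra_simps)
  have "(x + y) ^ (2 ^ i) = x ^ (2 ^ i) + y ^ (2 ^ i)" for i
  proof (induction i)
    case (Suc i)
    have "(x + y) ^ (2 ^ Suc i) = ((x + y) ^ (2 ^ i)) ^ 2"
      by (simp add: power_mult[symmetric] mult.commute)
    then show ?case
      unfolding Suc.IH sq by (simp add: power_mult[symmetric] mult.commute)
  qed simp
  then show ?thesis by (simp add: field_trace_def sum.distrib)
qed

text \<open>Read in the field, the traces are 0 or 1, and there 1 + 1 = 0; additivity therefore
  descends to \<open>bit\<close>.\<close>

lemma trace_bit_add: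
  fixes x y :: "'a::finite_field"
  assumes "CARD('a) = 2 ^ m"
  shows "trace_bit m (x + y) = trace_bit m x + trace_bit m y"
proof -
  have "of_bit (trace_bit m (x + y)) = of_bit (trace_bit m x) + (of_bit (trace_bit m y) :: 'a)"
    by (simp only: of_bit_trace_bit[OF assms] field_trace_add[OF assms])
  then show ?thesis
    by (cases "trace_bit m x"; cases "trace_bit m y"; cases "trace_bit m (x + y)")
      (auto simp: double_eq_0[OF assms])
qed

text \<open>The trace is a polynomial function of degree \<open>2 ^ (m - 1)\<close>, too small to vanish everywhere.\<close>

lemma trace_bit_nontrivial:
  assumes "card (UNIV :: 'a::finite_field set) = 2 ^ m"
  shows "\<exists>z :: 'a. trace_bit m z = 1"
proof -
  obtain k where k: "m = Suc k"
    using CARD_eq_power_imp_pos[OF assms] gr0_implies_Suc by blast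
  define p :: "'a poly" where "p = (\<Sum>i<m. monom 1 (2 ^ i))"
  \<comment> \<open>The exponents \<open>2 ^ i\<close> are pairwise distinct, so only the top
    summand contributes.\<close>
  have "coeff p (2 ^ k) = (\<Sum>i<m. if i = k then 1 else 0)"
    unfolding p_def coeff_sum by (rule sum.cong) auto
  then have "p \<noteq> 0" using k by auto
  have "degree p \<le> 2 ^ k"
    unfolding p_def by (rule degree_sum_le) (auto intro: order.trans[OF degree_monom_le] simp: k)
  have "card {x. poly p x = 0} \<le> 2 ^ k"
    using card_poly_roots_bound[OF \<open>p \<noteq> 0\<close>] \<open>degree p \<le> 2 ^ k\<close> by linarith
  also have "2 ^ k < CARD('a)" using assms k by simp
  finally have "{x. poly p x = 0} \<noteq> UNIV" by auto
  then obtain z where "poly p z \<noteq> 0" by auto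
  then have "field_trace m z \<noteq> 0"
    by (simp add: p_def poly_sum poly_monom field_trace_def)
  then show ?thesis by (auto simp: trace_bit_def)
qed

lemma sum_character_plane:
  fixes u v :: "'a::finite_field"
  assumes card: "CARD('a) = 2 ^ m" and uv: "(u, v) \<noteq> (0, 0)"
  shows "(\<Sum>x\<in>UNIV. \<Sum>y\<in>UNIV. bit_sign (trace_bit m (u * x + v * y))) = 0"
proof -
  obtain z :: 'a where z: "trace_bit m z = 1" using trace_bit_nontrivial[OF card] by blast
  define \<chi> where "\<chi> w = trace_bit m (u * fst w + v * snd w)" for w
  have add: "\<chi> (w + w') = \<chi> w + \<chi> w'" for w w'
    unfolding \<chi>_def trace_bit_add[OF card, symmetric] by (simp add: algebra_simps)
  \<comment> \<open>The point is chosen so that the linear form takes the value \<open>z\<close>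
    there.\<close>
  have "\<chi> (if u \<noteq> 0 then (z / u, 0) else (0, z / v)) = 1"
    using z uv by (auto simp: \<chi>_def)
  then have "\<not> (\<forall>w. \<chi> w = 0)" by (metis zero_neq_one)
  then have "(\<Sum>w\<in>UNIV. bit_sign (\<chi> w)) = 0"
    using sum_bit_sign_additive[of \<chi>] add by simp
  then show ?thesis
    unfolding \<chi>_def by (simp add: sum.cartesian_product case_prod_unfold)
qed

section \<open>Dimension over the field with two elements\<close>

text \<open>With only the scalars 0 and 1, linear combinations of a basis are sums over its subsets,
  so a subspace of dimension e has \<open>2 ^ e\<close> elements. This lets dimensions be read off
  from cardinalities.\<close>

lemma dim_scale_bit:
  fixes W :: "('a::finite_field \<times> 'a) set"
  assumes card: "CARD('a) = 2 ^ m" and sub: "module.subspace scale_bit W" and W: "card W = 2 ^ d"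
  shows "vector_space.dim scale_bit W = d"
proof -
  interpret vector_space "scale_bit :: bit \<Rightarrow> 'a \<times> 'a \<Rightarrow> 'a \<times> 'a"
    by (rule vector_space_scale_bit[OF card])
  obtain B where B: "B \<subseteq> W" "independent B" "W \<subseteq> span B" "card B = dim W"
    using basis_exists by blast
  have "span B = W" using B sub by (simp add: span_subspace)
  have fin: "finite B" by simp
  define \<phi> where "\<phi> A = (\<Sum>b\<in>B. scale_bit (of_bool (b \<in> A)) b)" for A
  have "bij_betw \<phi> (Pow B) W"
    unfolding bij_betw_def
  proof
    show "inj_on \<phi> (Pow B)"
    proof (rule inj_onI)
      fix A A' assume *: "A \<in> Pow B" "A' \<in> Pow B" "\<phi> A = \<phi> A'"
      let ?c = "\<lambda>b. of_bool (b \<in> A) - of_bool (b \<in> A') :: bit"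
      have sum_0: "(\<Sum>b\<in>B. scale_bit (?c b) b) = 0"
        using *(3) by (simp only: \<phi>_def scale_left_diff_distrib sum_subtractf) simp
      have "?c b = 0" if "b \<in> B" for b
        by (rule independentD[OF B(2) fin subset_refl sum_0 that])
      then show "A = A'" using *(1,2) by (fastforce simp: of_bool_def split: if_splits)
    qed
    show "\<phi> ` Pow B = W"
    proof
      show "\<phi> ` Pow B \<subseteq> W"
        unfolding \<open>span B = W\<close>[symmetric] \<phi>_def
        by (intro image_subsetI span_sum span_scale span_base)
      show "W \<subseteq> \<phi> ` Pow B"
      proof
        fix w assume "w \<in> W"
        then obtain c where c: "w = (\<Sum>b\<in>B. scale_bit (c b) b)"
          using \<open>span B = W\<close> span_finite[OF fin] by auto
        have "c b = of_bool (b \<in> {b \<in> B. c b = 1})" if "b \<in> B" for b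
          using that by (cases "c b") auto
        then have "w = \<phi> {b \<in> B. c b = 1}"
          unfolding c \<phi>_def by (intro sum.cong) auto
        then show "w \<in> \<phi> ` Pow B" by blast
      qed
    qed
  qed
  then have "(2::nat) ^ card B = 2 ^ d"
    using bij_betw_same_card card_Pow[OF fin] W by metis
  then show ?thesis using B(4) by simp
qed

text \<open>Multiplication by 0 or 1 yields the zero vector or the vector itself, so closure under
  scaling comes for free.\<close>

lemma subspace_scale_bit_iff:
  assumes card: "card (UNIV :: 'a::finite_field set) = 2 ^ m"
  shows "module.subspace scale_bit (W :: ('a \<times> 'a) set) \<longleftrightarrow> 0 \<in> W \<and> (\<forall>v\<in>W. \<forall>w\<in>W. v + w \<in> W)"
proof -
  interpret vector_space "scale_bit :: bit \<Rightarrow> 'a \<times> 'a \<Rightarrow> 'a \<times> 'a"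
    by (rule vector_space_scale_bit[OF card])
  have "scale_bit c v \<in> W" if "0 \<in> W" "v \<in> W" for c v
    using that by (cases c) (simp_all only: scale_zero_left scale_one)
  then show ?thesis by (auto simp: subspace_def)
qed

section \<open>The spread of a pre-quasifield\<close>

definition infinite_component :: "('a::zero \<times> 'b) set" where
  "infinite_component = {0} \<times> UNIV"

definition graph_component :: "('a \<Rightarrow> 'b \<Rightarrow> 'c) \<Rightarrow> 'a \<Rightarrow> ('b \<times> 'c) set" where
  "graph_component dia a = (\<lambda>x. (x, dia a x)) ` UNIV"

lemma mem_graph_component: "(x, y) \<in> graph_component dia a \<longleftrightarrow> y = dia a x"
  by (auto simp: graph_component_def)

context finite_left_prequasifield
begin

lemma zero_right: "a \<diamondop> 0 = 0"
  using distrib_left[of a 0 0] by simp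

lemma mult_right_cancel: "x \<noteq> 0 \<Longrightarrow> a \<diamondop> x = b \<diamondop> x \<Longrightarrow> a = b"
  using ex1_quotient by metis

lemma prequasi_div_unique: "x \<noteq> 0 \<Longrightarrow> prequasi_div dia (a \<diamondop> x) x = a"
  using mult_right_cancel prequasi_div_mult by metis

text \<open>Off the line at infinity, points are grouped by their quotient. The origin lies on every
  graph, and the last sum removes these extra occurrences. The general \<open>h\<close> allows two
  uses: \<open>h = g\<close> gives the Walsh transform, \<open>h = 0\<close> the character sum over
  the plane.\<close>

lemma sum_plane_by_slopes:
  fixes h :: "'q \<Rightarrow> bit" and \<chi> :: "'q \<Rightarrow> 'q \<Rightarrow> bit"
  assumes "h 0 = 0" "\<chi> 0 0 = 0"
  shows "(\<Sum>x\<in>UNIV. \<Sum>y\<in>UNIV. bit_sign (h (prequasi_div dia y x) + \<chi> x y)) =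
    (\<Sum>y\<in>UNIV. bit_sign (\<chi> 0 y)) +
    (\<Sum>a\<in>UNIV. bit_sign (h a) * (\<Sum>x\<in>UNIV. bit_sign (\<chi> x (a \<diamondop> x)))) -
    (\<Sum>a\<in>UNIV. bit_sign (h a))"
proof -
  let ?F = "\<lambda>x y. bit_sign (h (prequasi_div dia y x) + \<chi> x y)"
  have slopes: "(\<Sum>y\<in>UNIV. ?F x y) = (\<Sum>a\<in>UNIV. bit_sign (h a) * bit_sign (\<chi> x (a \<diamondop> x)))"
    if "x \<noteq> 0" for x
    by (rule sum.reindex_bij_witness[of _ "\<lambda>a. a \<diamondop> x" "\<lambda>y. prequasi_div dia y x"])
      (simp_all only: bit_sign_add, simp_all add: that prequasi_div_mult prequasi_div_unique)
  have split: "(\<Sum>x\<in>UNIV. k x) = k 0 + (\<Sum>x\<in>UNIV - {0}. k x)" for k :: "'q \<Rightarrow> int"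
    by (rule sum.remove) auto
  have "(\<Sum>x\<in>UNIV - {0}. \<Sum>y\<in>UNIV. ?F x y) =
      (\<Sum>a\<in>UNIV. bit_sign (h a) * (\<Sum>x\<in>UNIV - {0}. bit_sign (\<chi> x (a \<diamondop> x))))"
    unfolding sum_distrib_left by (subst (2) sum.swap) (intro sum.cong refl slopes, simp)
  \<comment> \<open>The 1 is the term at \<open>x = 0\<close>, where every graph passes through the
    origin.\<close>
  also have "\<dots> = (\<Sum>a\<in>UNIV. bit_sign (h a) * ((\<Sum>x\<in>UNIV. bit_sign (\<chi> x (a \<diamondop> x))) - 1))"
    by (subst (2) split) (simp add: zero_right assms)
  finally have "(\<Sum>x\<in>UNIV - {0}. \<Sum>y\<in>UNIV. ?F x y) = \<dots>" .
  \<comment> \<open>Division by 0 gives 0 by convention, and \<open>h 0 = 0\<close>, so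
    \<open>h\<close> leaves no sign on the line at infinity.\<close>
  moreover have "(\<Sum>y\<in>UNIV. ?F 0 y) = (\<Sum>y\<in>UNIV. bit_sign (\<chi> 0 y))"
    by (simp only: bit_sign_add) (simp add: prequasi_div_def assms)
  ultimately show ?thesis
    unfolding split[of "\<lambda>x. \<Sum>y\<in>UNIV. ?F x y"]
    by (simp only: right_diff_distrib sum_subtractf) simp
qed

end

text \<open>A point with nonzero first coordinate determines its slope uniquely by division, which
  gives both the covering and the trivial intersections. Injectivity is needed to count components,
  here and in the partial spread sum.\<close>

lemma spread_prequasifield:
  fixes dia :: "'a::finite_field \<Rightarrow> 'a \<Rightarrow> 'a"
  assumes card: "CARD('a) = 2 ^ m" and "finite_left_prequasifield dia"
  shows "spread m (insert infinite_component (range (graph_component dia)))"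
    and "inj (graph_component dia)"
proof -
  interpret finite_left_prequasifield dia by fact
  let ?G = "graph_component dia" and ?I = "infinite_component :: ('a \<times> 'a) set"
  show inj: "inj ?G"
  proof (rule injI)
    fix a b assume "?G a = ?G b"
    \<comment> \<open>Here 1 serves merely as a nonzero element; it need not be an identity for
      \<open>dia\<close>.\<close>
    then have "dia a 1 = dia b 1" by (metis mem_graph_component)
    then show "a = b" using mult_right_cancel[of 1] by simp
  qed
  \<comment> \<open>This point separates the line at infinity from all graphs, so it adds one to the
    count.\<close>
  have "(0, 1) \<in> ?I" "(0, 1) \<notin> ?G a" for a
    by (simp_all add: infinite_component_def mem_graph_component zero_right)
  then have I: "?I \<notin> range ?G" by blast
  have sub: "module.subspace scale_bit W \<and> card W = 2 ^ m" if "W \<in> insert ?I (range ?G)" for W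
    using that
  proof (elim insertE rangeE)
    assume "W = ?I"
    then show ?thesis
      by (auto simp: subspace_scale_bit_iff[OF card] infinite_component_def card_cartesian_product
          card zero_prod_def)
  next
    fix a assume W: "W = ?G a"
    have "card (?G a) = CARD('a)"
      unfolding graph_component_def by (rule card_image) (auto intro: injI)
    then show ?thesis
      by (auto simp: W subspace_scale_bit_iff[OF card] mem_graph_component card zero_prod_def
          zero_right distrib_left)
  qed
  have zero: "0 \<in> W" if "W \<in> insert ?I (range ?G)" for W
    using sub[OF that] by (simp add: subspace_scale_bit_iff[OF card])
  have IG: "?I \<inter> ?G a \<subseteq> {0}" for a
    by (auto simp: infinite_component_def mem_graph_component zero_right zero_prod_def)
  have GG: "?G a \<inter> ?G b \<subseteq> {0}" if "a \<noteq> b" for a b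
  proof
    fix w assume "w \<in> ?G a \<inter> ?G b"
    then obtain x where "w = (x, dia a x)" "dia a x = dia b x"
      by (cases w) (auto simp: mem_graph_component)
    then show "w \<in> {0}"
      using mult_right_cancel[of x a b] that by (cases "x = 0") (simp_all add: zero_right zero_prod_def)
  qed
  have "W \<inter> W' \<subseteq> {0}"
    if "W \<in> insert ?I (range ?G)" "W' \<in> insert ?I (range ?G)" "W \<noteq> W'" for W W'
    using that IG GG by (elim insertE rangeE) (simp_all, (metis Int_commute)+)
  then have "W \<inter> W' = {0}"
    if "W \<in> insert ?I (range ?G)" "W' \<in> insert ?I (range ?G)" "W \<noteq> W'" for W W'
    using zero that by (metis Int_iff empty_iff subset_singletonD)
  moreover have "\<Union> (insert ?I (range ?G)) = UNIV"
  proof (rule UNIV_eq_I[symmetric])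
    fix w :: "'a \<times> 'a"
    obtain x y where w: "w = (x, y)" by force
    show "w \<in> \<Union> (insert ?I (range ?G))"
    proof (cases "x = 0")
      case False
      then have "w \<in> ?G (prequasi_div dia y x)"
        by (simp add: w mem_graph_component prequasi_div_mult)
      then show ?thesis by blast
    qed (simp add: w infinite_component_def)
  qed
  moreover have "card (insert ?I (range ?G)) = 2 ^ m + 1"
    using I card_image[OF inj] card by simp
  ultimately show "spread m (insert ?I (range ?G))"
    unfolding spread_def using sub dim_scale_bit[OF card] by simp
qed

section \<open>Partial spread representation and bentness\<close>

lemma sum_indicator_graph_component:
  fixes dia :: "'a::finite_field \<Rightarrow> 'a \<Rightarrow> 'a"
  assumes card: "CARD('a) = 2 ^ m" and "2 \<le> m" and "finite_left_prequasifield dia"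
    and bal: "balanced m g" and "g 0 = 0"
  shows "g (prequasi_div dia y x) = (\<Sum>W\<in>graph_component dia ` {a. g a = 1}. indicator W (x, y))"
proof -
  interpret finite_left_prequasifield dia by fact
  have "(\<Sum>W\<in>graph_component dia ` {a. g a = 1}. indicator W (x, y)) =
      (\<Sum>a | g a = 1. of_bool (y = dia a x) :: bit)"
    using spread_prequasifield(2)[OF card assms(3)]
    by (subst sum.reindex) (auto simp: indicator_def mem_graph_component of_bool_def
        intro: inj_on_subset intro!: sum.cong)
  also have "\<dots> = g (prequasi_div dia y x)"
  proof (cases "x = 0")
    case True
    \<comment> \<open>All \<open>2 ^ (m - 1)\<close> chosen graphs meet at the origin. Their number
      is even once \<open>2 \<le> m\<close>, giving 0 = \<open>g 0\<close>; for \<open>m = 1\<close>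
      the sum there would be 1.\<close>
    have "even (card {a. g a = 1})"
      using bal \<open>2 \<le> m\<close> by (simp add: balanced_def)
    then have "of_nat (card {a. g a = 1}) = (0 :: bit)"
      by (metis dvdE of_nat_mult of_nat_numeral bit_numeral_even mult_zero_left)
    then show ?thesis
      using True \<open>g 0 = 0\<close> by (simp add: zero_right prequasi_div_def)
  next
    case False
    \<comment> \<open>Exactly one graph passes through the point, and it is among the chosen ones
      iff \<open>g\<close> is 1 at its slope.\<close>
    then have "y = dia a x \<longleftrightarrow> a = prequasi_div dia y x" for a
      using prequasi_div_mult prequasi_div_unique by metis
    then have "(\<Sum>a | g a = 1. of_bool (y = dia a x) :: bit) =
        (\<Sum>a | g a = 1. if a = prequasi_div dia y x then 1 else 0)"
      by (intro sum.cong refl) (simp only: of_bool_def)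
    also have "\<dots> = g (prequasi_div dia y x)"
      by (cases "g (prequasi_div dia y x)") (simp_all add: sum.delta)
    finally show ?thesis .
  qed
  finally show ?thesis by simp
qed

text \<open>For positive \<open>N\<close>, exactly one of the terms equals \<open>N\<close> and the
  others vanish, so the signs can only change the sign of the total.\<close>

lemma abs_signed_sum_single:
  fixes T :: "'a::finite \<Rightarrow> int"
  assumes S: "S = 0 \<or> S = N" and T: "\<And>a. T a = 0 \<or> T a = N" and "0 \<le> N"
    and total: "S + (\<Sum>a\<in>UNIV. T a) = N"
  shows "\<bar>S + (\<Sum>a\<in>UNIV. bit_sign (g a) * T a)\<bar> = N"
\<comment> \<open>In both of these situations every \<open>T a\<close> must vanish.\<close>
proof (cases "N = 0 \<or> S = N")
  case True
  have "T a = 0" for a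
  proof -
    have nonneg: "0 \<le> T a" for a using T[of a] \<open>0 \<le> N\<close> by auto
    have "(\<Sum>a\<in>UNIV. T a) = 0" using True S total by auto
    then show ?thesis using nonneg by (simp add: sum_nonneg_eq_0_iff)
  qed
  then show ?thesis using total \<open>0 \<le> N\<close> by simp
next
  case False
  then have sum: "S = 0" "(\<Sum>a\<in>UNIV. T a) = N" using S total by auto
  then obtain a where "T a \<noteq> 0" using False sum.neutral by metis
  then have a: "T a = N" using T by blast
  have remove: "(\<Sum>a\<in>UNIV. k a) = k a + (\<Sum>b\<in>UNIV - {a}. k b)" for k :: "'a \<Rightarrow> int"
    by (rule sum.remove) auto
  have nonneg: "0 \<le> T b" for b using T[of b] \<open>0 \<le> N\<close> by auto
  have "(\<Sum>b\<in>UNIV - {a}. T b) = 0" using sum a remove[of T] by simp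
  then have "T b = 0" if "b \<noteq> a" for b
    using nonneg that by (simp add: sum_nonneg_eq_0_iff)
  then have "(\<Sum>a\<in>UNIV. bit_sign (g a) * T a) = bit_sign (g a) * N"
    by (subst remove) (simp add: a)
  then show ?thesis using \<open>S = 0\<close> \<open>0 \<le> N\<close> by (cases "g a") simp_all
qed

lemma bent_prequasi_div:
  fixes dia :: "'a::finite_field \<Rightarrow> 'a \<Rightarrow> 'a"
  assumes card: "CARD('a) = 2 ^ m" and "finite_left_prequasifield dia"
    and bal: "balanced m g" and "g 0 = 0"
    and f: "\<And>x y. f (x, y) = g (prequasi_div dia y x)"
  shows "bent m f"
  unfolding bent_def
proof (intro allI)
  fix u v :: 'a
  interpret finite_left_prequasifield dia by fact
  note trace_add = trace_bit_add[OF card]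
  \<comment> \<open>Balancedness enters here: it cancels the correction term of
    \<open>sum_plane_by_slopes\<close>.\<close>
  note [simp] = sum_bit_sign_balanced[OF card CARD_eq_power_imp_pos[OF card] bal]
  have trace_0: "trace_bit m (0 :: 'a) = 0"
    using trace_add[of 0 0] by simp
  define \<chi> where "\<chi> x y = trace_bit m (u * x + v * y)" for x y
  define S where "S = (\<Sum>y\<in>UNIV. bit_sign (\<chi> 0 y))"
  define T where "T a = (\<Sum>x\<in>UNIV. bit_sign (\<chi> x (dia a x)))" for a
  have \<chi>_0: "\<chi> 0 0 = 0"
    by (simp add: \<chi>_def trace_0)
  have \<chi>_add: "\<chi> (x + x') (y + y') = \<chi> x y + \<chi> x' y'" for x y x' y'
    unfolding \<chi>_def trace_add[symmetric] by (simp add: algebra_simps)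
  have "walsh m f u v =
      (\<Sum>x\<in>UNIV. \<Sum>y\<in>UNIV. bit_sign (g (prequasi_div dia y x) + \<chi> x y))"
    unfolding walsh_def f bit_sign_def \<chi>_def sum.cartesian_product UNIV_Times_UNIV ..
  then have walsh: "walsh m f u v = S + (\<Sum>a\<in>UNIV. bit_sign (g a) * T a)"
    using sum_plane_by_slopes[of g \<chi>] \<chi>_0 \<open>g 0 = 0\<close>
    by (simp add: S_def T_def)
  show "\<bar>walsh m f u v\<bar> = 2 ^ m"
  proof (cases "(u, v) = (0, 0)")
    case True
    \<comment> \<open>For the trivial character all \<open>T a\<close> agree, so the weighted sum
      vanishes by balancedness and only \<open>S\<close> survives.\<close>
    then have "S = 2 ^ m" "T a = 2 ^ m" for a
      by (simp_all add: S_def T_def \<chi>_def trace_0 card)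
    then show ?thesis by (simp add: walsh sum_distrib_right[symmetric])
  next
    case False
    have character: "(\<Sum>x\<in>UNIV. bit_sign (\<psi> x)) = 0 \<or> (\<Sum>x\<in>UNIV. bit_sign (\<psi> x)) = 2 ^ m"
      if "\<And>x y. \<psi> (x + y) = \<psi> x + \<psi> y" for \<psi> :: "'a \<Rightarrow> bit"
      using sum_bit_sign_additive[OF that] card by (simp split: if_splits)
    have S: "S = 0 \<or> S = 2 ^ m"
      unfolding S_def
    proof (rule character)
      show "\<chi> 0 (y + y') = \<chi> 0 y + \<chi> 0 y'" for y y'
        using \<chi>_add[of 0 0 y y'] unfolding add_0 .
    qed
    have T: "T a = 0 \<or> T a = 2 ^ m" for a
      unfolding T_def by (rule character) (simp only: distrib_left \<chi>_add)
    \<comment> \<open>With \<open>h = 0\<close> all signs are 1, so the correction term is the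
      number of slopes, \<open>2 ^ m\<close>.\<close>
    have "(\<Sum>x\<in>UNIV. \<Sum>y\<in>UNIV. bit_sign (\<chi> x y)) = S + (\<Sum>a\<in>UNIV. T a) - 2 ^ m"
      using sum_plane_by_slopes[of "\<lambda>_. 0" \<chi>] \<chi>_0 unfolding add_0 by (simp add: S_def T_def card)
    then have "S + (\<Sum>a\<in>UNIV. T a) = 2 ^ m"
      using sum_character_plane[OF card False] by (simp add: \<chi>_def)
    then show ?thesis unfolding walsh using S T by (intro abs_signed_sum_single) auto
  qed
qed

theorem theorem3p1:
  fixes m :: nat
    and dia :: "'a::finite_field \<Rightarrow> 'a \<Rightarrow> 'a"
    and g :: "'a \<Rightarrow> bit"
    and f :: "'a \<times> 'a \<Rightarrow> bit"
  assumes "CARD('a) = 2 ^ m"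
    and "finite_left_prequasifield dia"
    and "balanced m g"
    and "g 0 = 0"
    and "\<And>x y. f (x, y) = g (prequasi_div dia y x)"
  shows "(2 \<le> m \<longrightarrow> PS_minus m f) \<and> bent m f"
proof (intro conjI impI)
  assume "2 \<le> m"
  note spread = spread_prequasifield[OF assms(1,2)]
  \<comment> \<open>The slopes with \<open>g a = 1\<close> select the components; the line at
    infinity is left out because \<open>f\<close> is \<open>g 0 = 0\<close> on it.\<close>
  let ?C = "graph_component dia ` {a. g a = 1}"
  have "card ?C = 2 ^ (m - 1)"
    using assms(3) card_image[OF inj_on_subset[OF spread(2) subset_UNIV]]
    by (simp add: balanced_def)
  moreover have "f w = (\<Sum>W\<in>?C. indicator W w)" for w
    using sum_indicator_graph_component[OF assms(1) \<open>2 \<le> m\<close> assms(2-4)] assms(5)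
    by (cases w) simp
  ultimately show "PS_minus m f"
    unfolding PS_minus_def using spread(1)
    by (intro exI[of _ ?C] exI[of _ "insert infinite_component (range (graph_component dia))"]) auto
next
  show "bent m f" using assms by (rule bent_prequasi_div)
qed

end
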